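(* Let $N, M, T$ be positive integers and $K>0$ a real number. Let $\mathcal{H}$ be a $4$-wise independent family of hash functions $[N]\to[M]$ and let $H$ be a uniformly random member of $\mathcal{H}$. Let $\mathbf{X}=(X_1,\dots,X_T)$ be a block $K$-source over $[N]^T$, independent of $H$. Then for every $\varepsilon>0$, the hashed sequence $(H,\mathbf{Y})=(H,H(X_1),\dots,H(X_T))$ is $\varepsilon$-close in statistical distance to some distribution $(H,\mathbf{Z})=(H,Z_1,\dots,Z_T)$ such that $$\mathrm{cp}(H,\mathbf{Z})\le \frac{1}{|\mathcal{H}|\cdot M^T}\left(1+\frac{M}{K}+\sqrt{\frac{2M}{K^2\varepsilon}}\right)^T.$$ In particular, if $K\ge MT+\sqrt{2MT^2/\varepsilon}$, then $\mathrm{cp}(H,\mathbf{Z})\le (1+\gamma)/(|\mathcal{H}|\cdot M^T)$ where $\gamma=2\cdot(MT+\sqrt{2MT^2/\varepsilon})/K$.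
   Context: $[n]=\{1,\dots,n\}$. A hash family $\mathcal{H}$ is a multiset of functions $[N]\to[M]$; it is $4$-wise independent if for all distinct $x_1,\dots,x_4\in[N]$, the values $H(x_1),\dots,H(x_4)$ (for $H$ uniform over $\mathcal{H}$) are independent and uniform over $[M]$. The collision probability of a random variable $X$ is $\mathrm{cp}(X)=\sum_x\Pr[X=x]^2$. A sequence $(X_1,\dots,X_T)$ over $[N]^T$ is a block $K$-source if for every $i\in[T]$ and every $x_{<i}$ in the support of $X_{<i}=(X_1,\dots,X_{i-1})$, $\mathrm{cp}(X_i\mid X_{<i}=x_{<i})\le 1/K$. Statistical distance: $\Delta(X,Y)=\max_S|\Pr[X\in S]-\Pr[Y\in S]|$; $\varepsilon$-close means $\Delta\le\varepsilon$.
   Formalization: 4-wise independence is required at any at most 4 distinct points (same for N≥4; for N<4 the literal condition is vacuous and the claim fails), and H is a member of the multiset with repeated functions counted as different outcomes, so that cp(H)=1/|H|. *)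

theory Defs
  imports "HOL-Probability.Probability"
begin

definition words :: "nat \<Rightarrow> nat \<Rightarrow> nat list set" where
  "words T N = {xs. length xs = T \<and> set xs \<subseteq> {1..N}}"

definition cp :: "'a pmf \<Rightarrow> real" where
  "cp p = (\<Sum>\<^sub>\<infinity>x. (pmf p x)\<^sup>2)"

definition stat_dist :: "'a pmf \<Rightarrow> 'a pmf \<Rightarrow> real" where
  "stat_dist p q = (SUP S. \<bar>measure_pmf.prob p S - measure_pmf.prob q S\<bar>)"

text \<open>List positions start at 0, so \<open>take i xs\<close> is the prefix strictly before the block \<open>xs ! i\<close>.\<close>

definition block_source :: "nat \<Rightarrow> nat \<Rightarrow> real \<Rightarrow> nat list pmf \<Rightarrow> bool" where
  "block_source T N K X \<longleftrightarrow> set_pmf X \<subseteq> words T N \<and>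
     (\<forall>i<T. \<forall>u\<in>set_pmf (map_pmf (take i) X).
        cp (map_pmf (\<lambda>xs. xs ! i) (cond_pmf X {xs. take i xs = u})) \<le> 1 / K)"

definition hash_family :: "nat \<Rightarrow> nat \<Rightarrow> (nat \<Rightarrow> nat) multiset \<Rightarrow> bool" where
  "hash_family N M HH \<longleftrightarrow> HH \<noteq> {#} \<and> set_mset HH \<subseteq> {1..N} \<rightarrow>\<^sub>E {1..M}"

text \<open>
  The values at any at most \<open>k\<close> distinct points are required to be independent and uniform.
  If \<open>k \<le> N\<close>, this is the same as requiring it for exactly \<open>k\<close> points (lemma
  \<open>kwise_independent_iff_card_eq\<close> below); for \<open>N < k\<close> the latter would be vacuous.
\<close>

definition kwise_independent :: "nat \<Rightarrow> nat \<Rightarrow> nat \<Rightarrow> (nat \<Rightarrow> nat) multiset \<Rightarrow> bool" where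
  "kwise_independent k N M HH \<longleftrightarrow> (\<forall>S\<subseteq>{1..N}. card S \<le> k \<longrightarrow>
     prob_space.indep_vars (measure_pmf (pmf_of_multiset HH))
       (\<lambda>_. count_space UNIV) (\<lambda>x h. h x) S \<and>
     (\<forall>x\<in>S. map_pmf (\<lambda>h. h x) (pmf_of_multiset HH) = pmf_of_set {1..M}))"

text \<open>
  A random member of a multiset is a random one of its \<open>size HH\<close> elements, where equal functions
  count as different elements: \<open>(f, j)\<close> is the \<open>j\<close>-th copy of \<open>f\<close>.  The collision probability
  of a random member is thus \<open>1 / size HH\<close> even if functions are repeated.
\<close>

definition random_member :: "'a multiset \<Rightarrow> ('a \<times> nat) pmf" where
  "random_member A = pmf_of_set {(f, j). j < count A f}"

text \<open>The joint law of \<open>(H, H(X\<^sub>1), \<dots>, H(X\<^sub>T))\<close> for \<open>H\<close> independent of \<open>X\<close>.\<close>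

definition hashed_seq ::
  "(nat \<Rightarrow> nat) multiset \<Rightarrow> nat list pmf \<Rightarrow> (((nat \<Rightarrow> nat) \<times> nat) \<times> nat list) pmf" where
  "hashed_seq HH X = map_pmf (\<lambda>(h, xs). (h, map (fst h) xs)) (pair_pmf (random_member HH) X)"

lemma kwise_independent_iff_card_eq:
  assumes "k \<le> N"
  shows "kwise_independent k N M HH \<longleftrightarrow> (\<forall>S\<subseteq>{1..N}. card S = k \<longrightarrow>
     prob_space.indep_vars (measure_pmf (pmf_of_multiset HH))
       (\<lambda>_. count_space UNIV) (\<lambda>x h. h x) S \<and>
     (\<forall>x\<in>S. map_pmf (\<lambda>h. h x) (pmf_of_multiset HH) = pmf_of_set {1..M}))"
    (is "_ \<longleftrightarrow> (\<forall>S\<subseteq>_. _ \<longrightarrow> ?Q S)")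
proof
  assume R: "\<forall>S\<subseteq>{1..N}. card S = k \<longrightarrow> ?Q S"
  show "kwise_independent k N M HH"
    unfolding kwise_independent_def
  proof (intro allI impI)
    fix S :: "nat set"
    assume S: "S \<subseteq> {1..N}" "card S \<le> k"
    obtain B where B: "S \<subseteq> B" "B \<subseteq> {1..N}" "card B = k"
      using exists_subset_between[of S k "{1..N}"] S assms by auto
    have "?Q B" using R B by blast
    then show "?Q S"
      using B(1) prob_space.indep_vars_subset[OF measure_pmf.prob_space_axioms] by blast
  qed
qed (auto simp: kwise_independent_def)

lemma map_fst_random_member:
  assumes "A \<noteq> {#}"
  shows "map_pmf fst (random_member A) = pmf_of_multiset A"
proof -
  let ?E = "{(f, j). j < count A f}"
  have E: "?E = (SIGMA f:set_mset A. {..<count A f})"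
    by (auto simp del: count_greater_zero_iff intro!: count_inI)
  have fin: "finite ?E" unfolding E by auto
  obtain g where "g \<in># A" using assms by blast
  then have "(g, 0) \<in> ?E" by simp
  then have ne: "?E \<noteq> {}" by blast
  have card: "card ?E = size A" unfolding E by (simp add: size_multiset_overloaded_eq)
  show ?thesis
  proof (rule pmf_eqI)
    fix f
    have "pmf (map_pmf fst (random_member A)) f = card (?E \<inter> fst -` {f}) / card ?E"
      unfolding random_member_def using fin ne
      by (simp add: pmf_map measure_pmf_of_set)
    also have "?E \<inter> fst -` {f} = Pair f ` {..<count A f}" by auto
    also have "card \<dots> = count A f" by (subst card_image) (auto simp: inj_on_def)
    finally show "pmf (map_pmf fst (random_member A)) f = pmf (pmf_of_multiset A) f"
      using assms card by simp
  qed
qed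

end

theory Submission
  imports Defs
begin

text \<open>
  Fix \<open>h\<close> and let \<open>c\<^sub>i(y)\<close> be \<open>M\<close> times the collision probability of \<open>Y\<^sub>i\<close> given \<open>Y\<^bsub><i\<^esub> = y\<^bsub><i\<^esub>\<close>, so
  \<open>c\<^sub>i \<ge> 1\<close>.  Follow the conditional laws of \<open>Y\<close> as long as the product of the \<open>c\<^sub>i\<close> stays below a
  budget \<open>b\<close>, and continue uniformly once it would exceed \<open>b\<close>.  The resulting law has collision
  probability at most \<open>b / M\<^sup>T\<close> and dominates that of \<open>Y\<close> on all \<open>y\<close> with
  \<open>c\<^sub>1(y) \<dots> c\<^sub>T(y) \<le> b\<close>, so its distance from \<open>Y\<close> is at most the probability of the other \<open>y\<close>.

  To bound that probability for \<open>b = (1 + M/K + \<beta>)\<^sup>T\<close>, use the arithmetic-geometric mean inequality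
  and Markov's inequality for the sum of the squared excesses \<open>(c\<^sub>i - 1 - M/K)\<^sub>+\<^sup>2\<close>.  Since
  \<open>Y\<^sub>i\<close> given \<open>Y\<^bsub><i\<^esub>\<close> is a mixture of the \<open>h(X\<^sub>i)\<close> given \<open>X\<^bsub><i\<^esub>\<close>, convexity reduces each term to a single
  block, where 4-wise independence makes the collision indicators of distinct pairs uncorrelated
  and bounds the second moment by \<open>2M/K\<^sup>2\<close>.
\<close>

subsection \<open>Collision probability\<close>

lemma cp_eq_sum:
  assumes "finite A" "set_pmf p \<subseteq> A"
  shows "cp p = (\<Sum>x\<in>A. (pmf p x)\<^sup>2)"
proof -
  have "cp p = (\<Sum>\<^sub>\<infinity>x\<in>A. (pmf p x)\<^sup>2)"
    unfolding cp_def using assms(2) by (intro infsum_cong_neutral) (auto simp: set_pmf_iff)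
  then show ?thesis using assms(1) by simp
qed

lemma cp_nonneg: "cp p \<ge> 0"
  unfolding cp_def by (intro infsum_nonneg) auto

text \<open>Cauchy-Schwarz against the total mass 1. It makes every factor charged to the budget at
  least 1, so a partial product that exceeds the budget never falls below it again.\<close>

lemma card_mult_cp_ge_1:
  assumes "finite A" "set_pmf p \<subseteq> A"
  shows "1 \<le> real (card A) * cp p"
  using sum_squared_le_sum_of_squares[of "pmf p" A] sum_pmf_eq_1[OF assms]
  by (simp add: cp_eq_sum[OF assms] mult.commute)

lemma cp_pmf_of_set:
  assumes "finite A" "A \<noteq> {}"
  shows "cp (pmf_of_set A) = 1 / real (card A)"
  using assms by (simp add: cp_eq_sum[of A] power2_eq_square)

lemma cp_map_inj:
  assumes "finite (set_pmf p)" "inj f"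
  shows "cp (map_pmf f p) = cp p"
proof -
  have "cp (map_pmf f p) = (\<Sum>x\<in>f ` set_pmf p. (pmf (map_pmf f p) x)\<^sup>2)"
    using assms by (intro cp_eq_sum) auto
  also have "\<dots> = (\<Sum>x\<in>set_pmf p. (pmf p x)\<^sup>2)"
    using assms(2) by (subst sum.reindex) (auto intro: inj_on_subset simp: pmf_map_inj')
  finally show ?thesis using assms by (simp add: cp_eq_sum[of "set_pmf p"])
qed

lemma pmf_bind_Pair:
  "pmf (bind_pmf w (\<lambda>a. map_pmf (Pair a) (Q a))) (a, b) = pmf w a * pmf (Q a) b"
proof -
  have "pmf (map_pmf (Pair x) (Q x)) (a, b) = indicator {a} x * pmf (Q a) b" for x
  proof (cases "x = a")
    case True
    then show ?thesis using pmf_map_inj'[of "Pair a" "Q a" b] by (simp add: inj_on_def)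
  next
    case False
    then have "(a, b) \<notin> set_pmf (map_pmf (Pair x) (Q x))" by auto
    then show ?thesis using False by (simp only: pmf_eq_0_set_pmf[symmetric]) simp
  qed
  then have "pmf (bind_pmf w (\<lambda>a. map_pmf (Pair a) (Q a))) (a, b) =
      measure_pmf.expectation w (\<lambda>x. indicator {a} x * pmf (Q a) b)"
    by (simp only: pmf_bind)
  also have "\<dots> = pmf w a * pmf (Q a) b" by (simp add: measure_pmf_single)
  finally show ?thesis .
qed

text \<open>The first component is kept, so two outcomes collide only if it agrees, and the squared
  masses factor. Used both for a first letter followed by its continuation and for a hash function
  followed by its sequence.\<close>

lemma cp_bind_Pair:
  assumes "finite A" "set_pmf w \<subseteq> A" "\<And>a. a \<in> A \<Longrightarrow> finite (set_pmf (Q a))"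
  shows "cp (bind_pmf w (\<lambda>a. map_pmf (Pair a) (Q a))) = (\<Sum>a\<in>A. (pmf w a)\<^sup>2 * cp (Q a))"
proof -
  have "cp (bind_pmf w (\<lambda>a. map_pmf (Pair a) (Q a))) =
      (\<Sum>x\<in>Sigma A (\<lambda>a. set_pmf (Q a)). (pmf (bind_pmf w (\<lambda>a. map_pmf (Pair a) (Q a))) x)\<^sup>2)"
    using assms by (intro cp_eq_sum) auto
  also have "\<dots> = (\<Sum>a\<in>A. \<Sum>b\<in>set_pmf (Q a). (pmf w a * pmf (Q a) b)\<^sup>2)"
    using assms by (subst sum.Sigma) (auto intro!: sum.cong simp: pmf_bind_Pair)
  also have "\<dots> = (\<Sum>a\<in>A. (pmf w a)\<^sup>2 * cp (Q a))"
    by (intro sum.cong refl)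
      (subst cp_eq_sum[OF assms(3) order_refl], simp_all add: power_mult_distrib sum_distrib_left)
  finally show ?thesis .
qed

lemma expectation_squared_le:
  fixes f :: "'a \<Rightarrow> real"
  assumes "finite (set_pmf w)"
  shows "(measure_pmf.expectation w f)\<^sup>2 \<le> measure_pmf.expectation w (\<lambda>u. (f u)\<^sup>2)"
  using measure_pmf.variance_positive[of w f]
  by (simp add: measure_pmf.variance_eq integrable_measure_pmf_finite assms)

text \<open>Convexity of squaring, applied to the probability of each outcome: mixing laws does not
  raise the collision probability above its average.\<close>

lemma cp_bind_le:
  assumes "finite (set_pmf w)" "\<And>u. u \<in> set_pmf w \<Longrightarrow> finite (set_pmf (q u))"
  shows "cp (bind_pmf w q) \<le> measure_pmf.expectation w (\<lambda>u. cp (q u))"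
proof -
  let ?A = "\<Union>u\<in>set_pmf w. set_pmf (q u)"
  have fin: "finite ?A" using assms by auto
  have "cp (bind_pmf w q) = (\<Sum>x\<in>?A. (measure_pmf.expectation w (\<lambda>u. pmf (q u) x))\<^sup>2)"
    by (subst cp_eq_sum[OF fin]) (auto simp: pmf_bind)
  also have "\<dots> \<le> (\<Sum>x\<in>?A. measure_pmf.expectation w (\<lambda>u. (pmf (q u) x)\<^sup>2))"
    by (intro sum_mono expectation_squared_le assms)
  also have "\<dots> = measure_pmf.expectation w (\<lambda>u. \<Sum>x\<in>?A. (pmf (q u) x)\<^sup>2)"
    by (subst Bochner_Integration.integral_sum)
      (auto intro: integrable_measure_pmf_finite assms)
  also have "\<dots> = measure_pmf.expectation w (\<lambda>u. cp (q u))"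
    by (intro integral_cong_AE AE_pmfI) (auto intro!: cp_eq_sum[OF fin, symmetric])
  finally show ?thesis .
qed

text \<open>Jensen's inequality for a convex function that is also nondecreasing. Monotonicity is
  what allows \<open>t\<close> to be only bounded by the mean of \<open>f\<close>, which is the form
  in which \<open>cp_bind_le\<close> delivers it.\<close>

lemma hinge_squared_le_expectation:
  fixes f :: "'a \<Rightarrow> real"
  assumes "finite (set_pmf w)" "t \<le> measure_pmf.expectation w f"
  shows "(max 0 (t - a))\<^sup>2 \<le> measure_pmf.expectation w (\<lambda>u. (max 0 (f u - a))\<^sup>2)"
proof -
  note int = integrable_measure_pmf_finite[OF assms(1)]
  have "t - a \<le> measure_pmf.expectation w (\<lambda>u. f u - a)"
    using assms(2) by (simp add: int)
  also have "\<dots> \<le> measure_pmf.expectation w (\<lambda>u. max 0 (f u - a))"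
    by (intro integral_mono int) auto
  finally have "max 0 (t - a) \<le> measure_pmf.expectation w (\<lambda>u. max 0 (f u - a))"
    by (simp add: integral_nonneg_AE)
  then have "(max 0 (t - a))\<^sup>2 \<le> (measure_pmf.expectation w (\<lambda>u. max 0 (f u - a)))\<^sup>2"
    by (intro power_mono) auto
  also note expectation_squared_le[OF assms(1)]
  finally show ?thesis .
qed

subsection \<open>Conditional laws\<close>

lemma bind_map_cond_pmf:
  "bind_pmf (map_pmf f p) (\<lambda>v. cond_pmf p {x. f x = v}) = p"
  by (intro bind_cond_pmf_cancel[where R = "\<lambda>v x. f x = v"])
    (auto simp: measure_map_pmf vimage_def eq_commute)

text \<open>Law of total expectation over the fibres of \<open>f\<close>.\<close>

lemma expectation_map_cond_pmf:
  fixes g :: "'a \<Rightarrow> real"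
  assumes "finite (set_pmf p)"
  shows "measure_pmf.expectation (map_pmf f p)
      (\<lambda>v. measure_pmf.expectation (cond_pmf p {x. f x = v}) g) = measure_pmf.expectation p g"
proof -
  have "measure_pmf.expectation p g =
      measure_pmf.expectation (bind_pmf (map_pmf f p) (\<lambda>v. cond_pmf p {x. f x = v})) g"
    by (simp add: bind_map_cond_pmf)
  also have "\<dots> = (\<Sum>v\<in>f ` set_pmf p.
      pmf (map_pmf f p) v *\<^sub>R measure_pmf.expectation (cond_pmf p {x. f x = v}) g)"
  proof (rule pmf_expectation_bind)
    fix v assume "v \<in> f ` set_pmf p"
    then have "set_pmf p \<inter> {x. f x = v} \<noteq> {}" by auto
    then show "finite (set_pmf (cond_pmf p {x. f x = v}))" using assms by simp
  qed (use assms in auto)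
  also have "\<dots> = measure_pmf.expectation (map_pmf f p)
      (\<lambda>v. measure_pmf.expectation (cond_pmf p {x. f x = v}) g)"
    using assms by (intro integral_measure_pmf[symmetric]) auto
  finally show ?thesis ..
qed

text \<open>Conditioning on a coarse statistic is a mixture of conditionings on a finer one. It is
  meant for \<open>t\<close> the true prefix and \<open>f\<close> the blockwise hash, so that
  \<open>f (t x)\<close> is the hashed prefix.\<close>

lemma cond_pmf_comp_eq_bind:
  assumes "v \<in> f ` t ` set_pmf p"
  shows "cond_pmf p {x. f (t x) = v} =
    bind_pmf (cond_pmf (map_pmf t p) {u. f u = v}) (\<lambda>u. cond_pmf p {x. t x = u})"
proof -
  let ?C = "{x. f (t x) = v}"
  let ?q = "cond_pmf p ?C"
  have ne: "set_pmf p \<inter> ?C \<noteq> {}" using assms by auto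
  have map: "map_pmf t ?q = cond_pmf (map_pmf t p) {u. f u = v}"
    using ne by (subst cond_map_pmf) (auto simp: vimage_def)
  \<comment> \<open>A reachable \<open>u\<close> satisfies \<open>f u = v\<close>, so the event
    \<open>t x = u\<close> lies inside \<open>?C\<close> and conditioning on \<open>?C\<close> first
    changes nothing.\<close>
  have "cond_pmf ?q {x. t x = u} = cond_pmf p {x. t x = u}" if "u \<in> t ` set_pmf ?q" for u
  proof -
    have u: "f u = v" "u \<in> t ` set_pmf p" using that ne by auto
    have ne1: "set_pmf ?q \<inter> {x. t x = u} \<noteq> {}" using that by auto
    have ne2: "set_pmf p \<inter> {x. t x = u} \<noteq> {}" using u by auto
    have pos: "measure p ?C \<noteq> 0" using ne by (rule measure_measure_pmf_not_zero)
    have "measure ?q {x. t x = u} = pmf (map_pmf t ?q) u"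
      by (simp add: pmf_map vimage_def)
    also have "\<dots> = pmf (map_pmf t p) u / measure (map_pmf t p) {u. f u = v}"
      unfolding map using u by (subst pmf_cond) auto
    also have "\<dots> = measure p {x. t x = u} / measure p ?C"
      by (simp add: pmf_map vimage_def)
    finally have m: "measure ?q {x. t x = u} = measure p {x. t x = u} / measure p ?C" .
    show ?thesis
      using u pos by (intro pmf_eqI) (auto simp: pmf_cond[OF ne1] pmf_cond[OF ne2] pmf_cond[OF ne] m)
  qed
  then have "bind_pmf (map_pmf t ?q) (\<lambda>u. cond_pmf p {x. t x = u}) =
      bind_pmf (map_pmf t ?q) (\<lambda>u. cond_pmf ?q {x. t x = u})"
    by (intro bind_pmf_cong) auto
  then show ?thesis unfolding map[symmetric] by (simp add: bind_map_cond_pmf)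
qed

subsection \<open>Trimming to a collision budget\<close>

lemma finite_words: "finite (words k M)"
  and card_words: "card (words k M) = M ^ k"
  using finite_lists_length_eq[of "{1..M}" k] card_lists_length_eq[of "{1..M}" k]
  by (simp_all add: words_def conj_commute)

lemma Cons_mem_words: "a # w \<in> words (Suc k) M \<longleftrightarrow> a \<in> {1..M} \<and> w \<in> words k M"
  by (auto simp: words_def)

lemma words_Suc_cases:
  assumes "w \<in> words (Suc k) M"
  obtains a w' where "w = a # w'" "a \<in> {1..M}" "w' \<in> words k M"
  using assms by (cases w) (auto simp: words_def)

text \<open>\<open>v\<close> is the prefix generated so far and \<open>b\<close> the part of the budget that it has left.\<close>

lemma dominating_pmf_small_cp:
  fixes \<kappa> :: "nat list \<Rightarrow> nat pmf"
  assumes \<kappa>: "\<And>v. set_pmf (\<kappa> v) \<subseteq> {1..M}" and "M > 0" "b \<ge> 1"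
  shows "\<exists>Q. set_pmf Q \<subseteq> words k M \<and> cp Q \<le> b / real M ^ k \<and>
    (\<forall>w\<in>words k M. (\<Prod>i<k. real M * cp (\<kappa> (v @ take i w))) \<le> b \<longrightarrow>
      (\<Prod>i<k. pmf (\<kappa> (v @ take i w)) (w ! i)) \<le> pmf Q w)"
  using \<open>b \<ge> 1\<close>
proof (induction k arbitrary: v b)
  case 0
  have "cp (return_pmf ([] :: nat list)) = 1" by (subst cp_eq_sum[of "{[]}"]) auto
  moreover have "words 0 M = {[]}" by (auto simp: words_def)
  ultimately show ?case using 0 by (intro exI[of _ "return_pmf []"]) simp
next
  case (Suc k)
  have ge1: "1 \<le> real M * cp (\<kappa> u)" for u
    using card_mult_cp_ge_1[OF _ \<kappa>[of u]] by simp
  define c where "c = real M * cp (\<kappa> v)"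
  have c1: "1 \<le> c" unfolding c_def by (rule ge1)
  show ?case
  proof (cases "c \<le> b")
    case False
    \<comment> \<open>The next factor alone breaks the budget and the later ones are at least 1, so
      no word has to be dominated. The uniform law fits any budget \<open>b \<ge> 1\<close>.\<close>
    let ?Q = "pmf_of_set (words (Suc k) M)"
    have ne: "words (Suc k) M \<noteq> {}"
      using card_words[of "Suc k" M] \<open>M > 0\<close> by auto
    have "cp ?Q \<le> b / real M ^ Suc k"
      using cp_pmf_of_set[OF finite_words ne] Suc.prems by (simp add: card_words divide_right_mono)
    moreover have "\<not> (\<Prod>i<Suc k. real M * cp (\<kappa> (v @ take i w))) \<le> b" for w
    proof -
      have "1 \<le> (\<Prod>i<k. real M * cp (\<kappa> (v @ take (Suc i) w)))"
        by (intro prod_ge_1 ge1)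
      then have "c * 1 \<le> c * (\<Prod>i<k. real M * cp (\<kappa> (v @ take (Suc i) w)))"
        using c1 by (intro mult_left_mono) auto
      also have "\<dots> = (\<Prod>i<Suc k. real M * cp (\<kappa> (v @ take i w)))"
        by (subst prod.lessThan_Suc_shift) (simp add: c_def)
      finally show ?thesis using False by simp
    qed
    ultimately show ?thesis
      using ne by (intro exI[of _ ?Q]) (auto simp: finite_words)
  next
    case True
    then have "1 \<le> b / c" using c1 by simp
    \<comment> \<open>The factor \<open>c\<close> depends on the prefix \<open>v\<close> and not on
      the next letter \<open>a\<close>, so every letter leaves the same budget
      \<open>b / c\<close>.\<close>
    then have "\<exists>Q. set_pmf Q \<subseteq> words k M \<and> cp Q \<le> b / c / real M ^ k \<and>
        (\<forall>w\<in>words k M. (\<Prod>i<k. real M * cp (\<kappa> ((v @ [a]) @ take i w))) \<le> b / c \<longrightarrow>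
        (\<Prod>i<k. pmf (\<kappa> ((v @ [a]) @ take i w)) (w ! i)) \<le> pmf Q w)" for a
      by (rule Suc.IH)
    then have "\<exists>Q. \<forall>a. set_pmf (Q a) \<subseteq> words k M \<and> cp (Q a) \<le> b / c / real M ^ k \<and>
        (\<forall>w\<in>words k M. (\<Prod>i<k. real M * cp (\<kappa> ((v @ [a]) @ take i w))) \<le> b / c \<longrightarrow>
        (\<Prod>i<k. pmf (\<kappa> ((v @ [a]) @ take i w)) (w ! i)) \<le> pmf (Q a) w)"
      by (intro choice allI)
    then obtain Q where *: "\<forall>a. set_pmf (Q a) \<subseteq> words k M \<and> cp (Q a) \<le> b / c / real M ^ k \<and>
        (\<forall>w\<in>words k M. (\<Prod>i<k. real M * cp (\<kappa> ((v @ [a]) @ take i w))) \<le> b / c \<longrightarrow>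
        (\<Prod>i<k. pmf (\<kappa> ((v @ [a]) @ take i w)) (w ! i)) \<le> pmf (Q a) w)"
      by (elim exE)
    have Q: "set_pmf (Q a) \<subseteq> words k M" for a using * by blast
    have cpQ: "cp (Q a) \<le> b / c / real M ^ k" for a using * by blast
    have dom: "(\<Prod>i<k. pmf (\<kappa> ((v @ [a]) @ take i w)) (w ! i)) \<le> pmf (Q a) w"
      if "w \<in> words k M" "(\<Prod>i<k. real M * cp (\<kappa> ((v @ [a]) @ take i w))) \<le> b / c" for a w
      using * that by blast
    let ?P = "bind_pmf (\<kappa> v) (\<lambda>a. map_pmf (Pair a) (Q a))"
    let ?f = "\<lambda>(a, w). a # w"
    let ?Q = "map_pmf ?f ?P"
    have inj: "inj ?f" by (auto simp: inj_def)
    have fQ: "finite (set_pmf (Q a))" for a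
      using Q finite_words by (rule finite_subset)
    have fP: "finite (set_pmf ?P)"
      using fQ finite_subset[OF \<kappa>[of v]] by simp
    have "cp ?Q = cp ?P" using fP inj by (rule cp_map_inj)
    also have "\<dots> = (\<Sum>a\<in>{1..M}. (pmf (\<kappa> v) a)\<^sup>2 * cp (Q a))"
      using \<kappa> fQ by (intro cp_bind_Pair) auto
    also have "\<dots> \<le> (\<Sum>a\<in>{1..M}. (pmf (\<kappa> v) a)\<^sup>2 * (b / c / real M ^ k))"
      by (intro sum_mono mult_left_mono cpQ) auto
    also have "\<dots> = cp (\<kappa> v) * (b / c / real M ^ k)"
      using \<kappa> by (simp add: cp_eq_sum[of "{1..M}"] sum_distrib_right sum_divide_distrib)
    \<comment> \<open>Since \<open>c\<close> is \<open>M\<close> times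
      \<open>cp (\<kappa> v)\<close>, the collision probability of the first letter cancels the
      division of the budget exactly.\<close>
    also have "\<dots> = b / real M ^ Suc k"
      using c1 \<open>M > 0\<close> by (auto simp: c_def)
    finally have "cp ?Q \<le> b / real M ^ Suc k" .
    moreover have "set_pmf ?Q \<subseteq> words (Suc k) M"
      using Q \<kappa>[of v] by (fastforce simp: Cons_mem_words)
    moreover have "(\<Prod>i<Suc k. pmf (\<kappa> (v @ take i w)) (w ! i)) \<le> pmf ?Q w"
      if w: "w \<in> words (Suc k) M" and le: "(\<Prod>i<Suc k. real M * cp (\<kappa> (v @ take i w))) \<le> b" for w
    proof -
      obtain a w' where w': "w = a # w'" "w' \<in> words k M" using w by (rule words_Suc_cases)
      have "c * (\<Prod>i<k. real M * cp (\<kappa> ((v @ [a]) @ take i w'))) \<le> b"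
        using le unfolding w' by (subst (asm) prod.lessThan_Suc_shift) (simp add: c_def)
      then have "(\<Prod>i<k. real M * cp (\<kappa> ((v @ [a]) @ take i w'))) \<le> b / c"
        using c1 by (simp add: field_simps)
      from dom[OF w'(2) this]
      have "pmf (\<kappa> v) a * (\<Prod>i<k. pmf (\<kappa> ((v @ [a]) @ take i w')) (w' ! i)) \<le>
          pmf (\<kappa> v) a * pmf (Q a) w'"
        by (intro mult_left_mono) auto
      also have "\<dots> = pmf ?Q w"
        using pmf_map_inj'[OF inj, of ?P "(a, w')"] unfolding w' by (simp add: pmf_bind_Pair)
      finally show ?thesis
        unfolding w' by (subst prod.lessThan_Suc_shift) simp
    qed
    ultimately show ?thesis by (intro exI[of _ ?Q]) auto
  qed
qed

text \<open>Inside \<open>G\<close> the law \<open>p\<close> has no excess over \<open>q\<close>, so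
  on any event its excess is at most the mass of \<open>p\<close> outside \<open>G\<close>. Passing
  to the complementary event bounds the difference of the opposite sign.\<close>

lemma stat_dist_le:
  assumes "\<And>x. x \<in> G \<Longrightarrow> pmf p x \<le> pmf q x"
  shows "stat_dist p q \<le> measure_pmf.prob p (- G)"
proof -
  have le: "measure_pmf.prob p S - measure_pmf.prob q S \<le> measure_pmf.prob p (- G)" for S
  proof -
    have "measure_pmf.prob p (S \<inter> G) \<le> measure_pmf.prob q (S \<inter> G)"
      using assms unfolding measure_pmf_conv_infsetsum
      by (intro infsetsum_mono pmf_abs_summable) auto
    also have "\<dots> \<le> measure_pmf.prob q S" by (intro measure_pmf.finite_measure_mono) auto
    finally have "measure_pmf.prob p (S \<inter> G) \<le> measure_pmf.prob q S" .
    moreover have "measure_pmf.prob p S = measure_pmf.prob p (S \<inter> G) + measure_pmf.prob p (S - G)"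
      by (subst measure_pmf.finite_measure_Union[symmetric])
        (auto intro: arg_cong[where f = "measure_pmf.prob p"])
    moreover have "measure_pmf.prob p (S - G) \<le> measure_pmf.prob p (- G)"
      by (intro measure_pmf.finite_measure_mono) auto
    ultimately show ?thesis by linarith
  qed
  show ?thesis
    unfolding stat_dist_def
  proof (rule cSUP_least)
    fix S
    have "measure_pmf.prob r (- S) = 1 - measure_pmf.prob r S" for r :: "'a pmf"
      using measure_pmf.prob_compl[of S r] by (simp add: Compl_eq_Diff_UNIV)
    then show "\<bar>measure_pmf.prob p S - measure_pmf.prob q S\<bar> \<le> measure_pmf.prob p (- G)"
      using le[of S] le[of "- S"] by simp
  qed simp
qed

subsection \<open>Collisions under a 4-wise independent family\<close>

lemma prob_partition:
  assumes "finite A" "\<And>h. h \<in> set_pmf p \<Longrightarrow> f h \<in> A"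
  shows "measure_pmf.prob p {h. P h} = (\<Sum>a\<in>A. measure_pmf.prob p {h. f h = a \<and> P h})"
proof -
  have "measure_pmf.prob p {h. P h} = measure_pmf.prob p (\<Union>a\<in>A. {h. f h = a \<and> P h})"
    using assms(2) by (intro measure_pmf.finite_measure_eq_AE AE_pmfI) auto
  also have "\<dots> = (\<Sum>a\<in>A. measure_pmf.prob p {h. f h = a \<and> P h})"
    using assms(1) by (intro measure_pmf.finite_measure_finite_Union) (auto simp: disjoint_family_on_def)
  finally show ?thesis .
qed

lemma kwise_independent_prob:
  assumes "kwise_independent k N M HH" "S \<subseteq> {1..N}" "card S \<le> k" "\<And>x. x \<in> S \<Longrightarrow> g x \<in> {1..M}"
  shows "measure_pmf.prob (pmf_of_multiset HH) {h. \<forall>x\<in>S. h x = g x} = 1 / real M ^ card S"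
proof (cases "S = {}")
  case False
  let ?p = "pmf_of_multiset HH"
  have ind: "prob_space.indep_vars ?p (\<lambda>_. count_space UNIV) (\<lambda>x h. h x) S"
    and unif: "\<And>x. x \<in> S \<Longrightarrow> map_pmf (\<lambda>h. h x) ?p = pmf_of_set {1..M}"
    using assms unfolding kwise_independent_def by blast+
  have "{h. \<forall>x\<in>S. h x = g x} = (\<Inter>x\<in>S. (\<lambda>h. h x) -` {g x} \<inter> space (measure_pmf ?p))"
    by auto
  also have "measure_pmf.prob ?p \<dots> =
      (\<Prod>x\<in>S. measure_pmf.prob ?p ((\<lambda>h. h x) -` {g x} \<inter> space (measure_pmf ?p)))"
    using ind False finite_subset[OF assms(2)] 
    by (intro prob_space.indep_varsD_finite[OF measure_pmf.prob_space_axioms]) auto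
  also have "\<dots> = (\<Prod>x\<in>S. pmf (map_pmf (\<lambda>h. h x) ?p) (g x))"
    by (simp add: pmf_map)
  also have "\<dots> = (\<Prod>x\<in>S. 1 / real M)"
    using assms(4) by (intro prod.cong refl) (force simp: unif)
  finally show ?thesis by (simp add: power_one_over)
qed simp

context
  fixes N M :: nat and HH :: "(nat \<Rightarrow> nat) multiset"
  assumes M: "M > 0" and fam: "hash_family N M HH" and ind: "kwise_independent 4 N M HH"
begin

abbreviation hprob :: "(nat \<Rightarrow> nat) set \<Rightarrow> real" where
  "hprob \<equiv> measure_pmf.prob (pmf_of_multiset HH)"

abbreviation hexp :: "((nat \<Rightarrow> nat) \<Rightarrow> real) \<Rightarrow> real" where
  "hexp \<equiv> measure_pmf.expectation (pmf_of_multiset HH)"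

lemma hash_range: "h \<in> set_pmf (pmf_of_multiset HH) \<Longrightarrow> x \<in> {1..N} \<Longrightarrow> h x \<in> {1..M}"
  using fam unfolding hash_family_def by (auto simp: PiE_iff subset_eq)

text \<open>Split by the common value: each of the \<open>M\<close> values is taken at both points
  with probability \<open>1 / M\<^sup>2\<close>.\<close>

lemma prob_collision:
  assumes "x \<in> {1..N}" "x' \<in> {1..N}" "x \<noteq> x'"
  shows "hprob {h. h x = h x'} = 1 / real M"
proof -
  have "hprob {h. h x = h x'} = (\<Sum>a\<in>{1..M}. hprob {h. h x = a \<and> h x = h x'})"
    using assms by (intro prob_partition[where f = "\<lambda>h. h x"] hash_range) auto
  also have "\<dots> = (\<Sum>a\<in>{1..M}. hprob {h. \<forall>y\<in>{x, x'}. h y = a})"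
    by (intro sum.cong refl arg_cong[where f = hprob]) auto
  also have "\<dots> = (\<Sum>a\<in>{1..M}. 1 / real M ^ card {x, x'})"
    using assms by (intro sum.cong refl kwise_independent_prob[OF ind]) auto
  finally show ?thesis using assms M by (simp add: power2_eq_square)
qed

lemma prob_triple_collision:
  assumes "{x, y, z} \<subseteq> {1..N}" "distinct [x, y, z]"
  shows "hprob {h. h x = h y \<and> h x = h z} = 1 / (real M)\<^sup>2"
proof -
  have "hprob {h. h x = h y \<and> h x = h z} = (\<Sum>a\<in>{1..M}. hprob {h. h x = a \<and> h x = h y \<and> h x = h z})"
    using assms by (intro prob_partition[where f = "\<lambda>h. h x"] hash_range) auto
  also have "\<dots> = (\<Sum>a\<in>{1..M}. hprob {h. \<forall>u\<in>{x, y, z}. h u = a})"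
    by (intro sum.cong refl arg_cong[where f = hprob]) auto
  also have "\<dots> = (\<Sum>a\<in>{1..M}. 1 / real M ^ card {x, y, z})"
    using assms by (intro sum.cong refl kwise_independent_prob[OF ind]) auto
  finally show ?thesis using assms M by (simp add: power2_eq_square power3_eq_cube)
qed

text \<open>Two different unordered pairs are either disjoint, which is where all four points of
  independence enter, or share one point, and then both collisions together are a triple collision.
  Either way the probability is the product of the two single ones, so the collision events are
  uncorrelated.\<close>

lemma prob_double_collision:
  assumes "{x, x', z, z'} \<subseteq> {1..N}" "x \<noteq> x'" "z \<noteq> z'" "{x, x'} \<noteq> {z, z'}"
  shows "hprob {h. h x = h x' \<and> h z = h z'} = 1 / (real M)\<^sup>2"
proof (cases "{x, x'} \<inter> {z, z'} = {}")
  case True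
  then have d: "distinct [x, x', z, z']" using assms by auto
  have "hprob {h. h x = h x' \<and> h z = h z'} =
      (\<Sum>a\<in>{1..M}\<times>{1..M}. hprob {h. (h x, h z) = a \<and> h x = h x' \<and> h z = h z'})"
    using assms hash_range by (intro prob_partition[where f = "\<lambda>h. (h x, h z)"]) auto
  also have "\<dots> = (\<Sum>a\<in>{1..M}\<times>{1..M}.
      hprob {h. \<forall>u\<in>{x, x', z, z'}. h u = (if u = x \<or> u = x' then fst a else snd a)})"
  proof (intro sum.cong refl arg_cong[where f = hprob] Collect_cong)
    fix a :: "nat \<times> nat" and h :: "nat \<Rightarrow> nat"
    show "(h x, h z) = a \<and> h x = h x' \<and> h z = h z' \<longleftrightarrow>
        (\<forall>u\<in>{x, x', z, z'}. h u = (if u = x \<or> u = x' then fst a else snd a))"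
      using d by (cases a) (simp, metis)
  qed
  also have "\<dots> = (\<Sum>a\<in>{1..M}\<times>{1..M}. 1 / real M ^ card {x, x', z, z'})"
  proof (intro sum.cong refl)
    fix a assume a: "a \<in> {1..M} \<times> {1..M}"
    show "hprob {h. \<forall>u\<in>{x, x', z, z'}. h u = (if u = x \<or> u = x' then fst a else snd a)} =
        1 / real M ^ card {x, x', z, z'}"
      by (rule kwise_independent_prob[OF ind assms(1)]) (use a d in auto)
  qed
  finally show ?thesis using d M by (simp add: power2_eq_square power4_eq_xxxx)
next
  case False
  then consider "z = x" | "z = x'" | "z' = x" | "z' = x'" by auto
  then show ?thesis
  proof cases
    case 1
    then have eq: "{h. h x = h x' \<and> h z = h z'} = {h. h x = h x' \<and> h x = h z'}" by auto
    show ?thesis unfolding eq by (rule prob_triple_collision) (use 1 assms in auto)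
  next
    case 2
    then have eq: "{h. h x = h x' \<and> h z = h z'} = {h. h x' = h x \<and> h x' = h z'}" by auto
    show ?thesis unfolding eq by (rule prob_triple_collision) (use 2 assms in auto)
  next
    case 3
    then have eq: "{h. h x = h x' \<and> h z = h z'} = {h. h x = h x' \<and> h x = h z}" by auto
    show ?thesis unfolding eq by (rule prob_triple_collision) (use 3 assms in auto)
  next
    case 4
    then have eq: "{h. h x = h x' \<and> h z = h z'} = {h. h x' = h x \<and> h x' = h z}" by auto
    show ?thesis unfolding eq by (rule prob_triple_collision) (use 4 assms in auto)
  qed
qed

text \<open>Scaled and shifted to have mean 0 over the family at a pair of distinct points of the
  domain, so that its second moments are covariances. At a pair \<open>(x, x)\<close> it is the
  constant \<open>M - 1\<close>.\<close>

definition centred_collision :: "nat \<times> nat \<Rightarrow> (nat \<Rightarrow> nat) \<Rightarrow> real" where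
  "centred_collision d h = real M * of_bool (h (fst d) = h (snd d)) - 1"

lemma finite_set_pmf_of_HH: "finite (set_pmf (pmf_of_multiset HH))"
  using fam by (auto simp: hash_family_def)

lemma integrable_HH: "integrable (measure_pmf (pmf_of_multiset HH)) (f :: (nat \<Rightarrow> nat) \<Rightarrow> real)"
  by (rule integrable_measure_pmf_finite[OF finite_set_pmf_of_HH])

text \<open>Pairs are ordered here, so \<open>d\<close> and its swap describe the same collision
  event and are fully correlated; different events are uncorrelated. The value \<open>M - 1\<close>
  is the variance of one event after scaling.\<close>

lemma expectation_centred_collision_mult:
  assumes "d \<in> {1..N} \<times> {1..N}" "e \<in> {1..N} \<times> {1..N}" "fst d \<noteq> snd d" "fst e \<noteq> snd e"
  shows "hexp (\<lambda>h. centred_collision d h * centred_collision e h) = (if e = d \<or> e = prod.swap d then real M - 1 else 0)"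
proof -
  obtain x x' z z' where de: "d = (x, x')" "e = (z, z')" by (cases d, cases e)
  let ?I = "\<lambda>P h. indicator {h. P h} h :: real"
  have "centred_collision d h * centred_collision e h = (real M)\<^sup>2 * ?I (\<lambda>h. h x = h x' \<and> h z = h z') h
      - real M * ?I (\<lambda>h. h x = h x') h - real M * ?I (\<lambda>h. h z = h z') h + 1" for h
    by (auto simp: centred_collision_def de indicator_def algebra_simps power2_eq_square)
  then have "hexp (\<lambda>h. centred_collision d h * centred_collision e h) =
      (real M)\<^sup>2 * hprob {h. h x = h x' \<and> h z = h z'}
      - real M * hprob {h. h x = h x'} - real M * hprob {h. h z = h z'} + 1"
    by (simp add: integrable_HH)
  also have "\<dots> = (real M)\<^sup>2 * hprob {h. h x = h x' \<and> h z = h z'} - 1"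
    using assms M by (simp add: de prob_collision)
  also have "\<dots> = (if e = d \<or> e = prod.swap d then real M - 1 else 0)"
  proof (cases "{x, x'} = {z, z'}")
    case True
    then have eq: "{h. h x = h x' \<and> h z = h z'} = {h. h x = h x'}" and ed: "e = d \<or> e = prod.swap d"
      by (auto simp: de doubleton_eq_iff)
    have "hprob {h. h x = h x' \<and> h z = h z'} = 1 / real M"
      unfolding eq using assms by (intro prob_collision) (auto simp: de)
    then show ?thesis using ed M by (simp add: power2_eq_square)
  next
    case False
    then have "hprob {h. h x = h x' \<and> h z = h z'} = 1 / (real M)\<^sup>2"
      using assms by (intro prob_double_collision) (auto simp: de)
    then show ?thesis using False M by (auto simp: de)
  qed
  finally show ?thesis .
qed

lemma expectation_sum_centred_squared:
  fixes p :: "nat pmf"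
  assumes p: "set_pmf p \<subseteq> {1..N}"
  defines "D \<equiv> {d\<in>{1..N} \<times> {1..N}. fst d \<noteq> snd d}"
  shows "hexp (\<lambda>h. (\<Sum>d\<in>D. pmf p (fst d) * pmf p (snd d) * centred_collision d h)\<^sup>2) \<le> 2 * real M * (cp p)\<^sup>2"
proof -
  define w where "w d = pmf p (fst d) * pmf p (snd d)" for d
  have fD: "finite D" unfolding D_def by auto
  have "hexp (\<lambda>h. (\<Sum>d\<in>D. w d * centred_collision d h)\<^sup>2) =
      hexp (\<lambda>h. \<Sum>d\<in>D. \<Sum>e\<in>D. w d * w e * (centred_collision d h * centred_collision e h))"
    by (simp add: power2_eq_square sum_product mult_ac)
  also have "\<dots> = (\<Sum>d\<in>D. \<Sum>e\<in>D. w d * w e * hexp (\<lambda>h. centred_collision d h * centred_collision e h))"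
    by (simp add: integrable_HH)
  \<comment> \<open>For each \<open>d\<close> only \<open>e = d\<close> and its swap survive, both
    with weight \<open>w d\<close>; hence the factor 2.\<close>
  also have "\<dots> = (\<Sum>d\<in>D. 2 * (real M - 1) * (w d)\<^sup>2)"
  proof (intro sum.cong refl)
    fix d assume d: "d \<in> D"
    have "(\<Sum>e\<in>D. w d * w e * hexp (\<lambda>h. centred_collision d h * centred_collision e h)) =
        (\<Sum>e\<in>{d, prod.swap d}. w d * w e * hexp (\<lambda>h. centred_collision d h * centred_collision e h))"
      using d fD by (intro sum.mono_neutral_right) (auto simp: D_def expectation_centred_collision_mult)
    also have "\<dots> = (\<Sum>e\<in>{d, prod.swap d}. (real M - 1) * (w d)\<^sup>2)"
      using d by (intro sum.cong refl)
        (auto simp: D_def expectation_centred_collision_mult w_def power2_eq_square)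
    also have "\<dots> = 2 * (real M - 1) * (w d)\<^sup>2"
      using d by (auto simp: D_def prod_eq_iff)
    finally show "(\<Sum>e\<in>D. w d * w e * hexp (\<lambda>h. centred_collision d h * centred_collision e h)) =
        2 * (real M - 1) * (w d)\<^sup>2" .
  qed
  also have "\<dots> \<le> (\<Sum>d\<in>D. 2 * real M * (w d)\<^sup>2)"
    by (intro sum_mono mult_right_mono) auto
  \<comment> \<open>Putting the diagonal back lets the sum of squared weights factor into
    \<open>(cp p)\<^sup>2\<close>.\<close>
  also have "\<dots> \<le> (\<Sum>d\<in>{1..N}\<times>{1..N}. 2 * real M * (w d)\<^sup>2)"
    unfolding D_def by (intro sum_mono2) auto
  also have "\<dots> = 2 * real M * (cp p)\<^sup>2"
    unfolding cp_eq_sum[OF finite_atLeastAtMost p] power2_eq_square[of "sum _ _"] sum_product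
    by (simp add: w_def sum.cartesian_product case_prod_beta power_mult_distrib sum_distrib_left)
  finally show ?thesis unfolding w_def .
qed

text \<open>The collision probability after hashing is the chance that two independent samples of
  \<open>p\<close> meet under \<open>h\<close>. Equal samples always meet and give the deterministic
  term; distinct samples give a fluctuation with mean 0 over the family.\<close>

lemma cp_map_eq:
  fixes p :: "nat pmf"
  assumes p: "set_pmf p \<subseteq> {1..N}"
  shows "real M * cp (map_pmf h p) - 1 = (real M - 1) * cp p +
    (\<Sum>d\<in>{d\<in>{1..N} \<times> {1..N}. fst d \<noteq> snd d}. pmf p (fst d) * pmf p (snd d) * centred_collision d h)"
proof -
  let ?A = "{1..N}"
  let ?w = "\<lambda>d. pmf p (fst d) * pmf p (snd d)"
  have pm: "pmf (map_pmf h p) b = (\<Sum>x\<in>?A. pmf p x * of_bool (h x = b))" for b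
  proof -
    have "pmf (map_pmf h p) b = measure_pmf.expectation p (indicator (h -` {b}))"
      by (simp add: pmf_map)
    also have "indicator (h -` {b}) = (\<lambda>x. of_bool (h x = b) :: real)"
      by (auto simp: indicator_def)
    also have "measure_pmf.expectation p \<dots> = (\<Sum>x\<in>?A. of_bool (h x = b) * pmf p x)"
      using p by (intro integral_measure_pmf_real) auto
    finally show ?thesis by (simp only: mult.commute)
  qed
  have "cp (map_pmf h p) = (\<Sum>b\<in>h ` ?A. (\<Sum>x\<in>?A. pmf p x * of_bool (h x = b))\<^sup>2)"
    using p by (subst cp_eq_sum[of "h ` ?A"]) (auto simp: pm)
  also have "\<dots> = (\<Sum>b\<in>h ` ?A. \<Sum>d\<in>?A\<times>?A. ?w d * (of_bool (h (fst d) = b) * of_bool (h (snd d) = b)))"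
    unfolding power2_eq_square sum_product sum.cartesian_product
    by (intro sum.cong refl) (simp add: case_prod_beta mult_ac)
  also have "\<dots> = (\<Sum>d\<in>?A\<times>?A. ?w d * (\<Sum>b\<in>h ` ?A. of_bool (h (fst d) = b) * of_bool (h (snd d) = b)))"
    by (subst sum.swap) (simp only: sum_distrib_left)
  also have "\<dots> = (\<Sum>d\<in>?A\<times>?A. ?w d * of_bool (h (fst d) = h (snd d)))"
  proof (intro sum.cong refl arg_cong2[where f = times])
    fix d assume "d \<in> ?A\<times>?A"
    then have "h (fst d) \<in> h ` ?A" by auto
    then show "(\<Sum>b\<in>h ` ?A. of_bool (h (fst d) = b) * of_bool (h (snd d) = b)) =
        (of_bool (h (fst d) = h (snd d)) :: real)"
      by (subst sum.remove[of _ "h (fst d)"]) (auto simp: sum.neutral)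
  qed
  finally have cp: "cp (map_pmf h p) = (\<Sum>d\<in>?A\<times>?A. ?w d * of_bool (h (fst d) = h (snd d)))" .
  have "(\<Sum>d\<in>?A\<times>?A. ?w d) = (\<Sum>x\<in>?A. pmf p x) * (\<Sum>x\<in>?A. pmf p x)"
    unfolding sum_product sum.cartesian_product by (simp add: case_prod_beta)
  then have one: "(\<Sum>d\<in>?A\<times>?A. ?w d) = 1"
    using sum_pmf_eq_1[OF finite_atLeastAtMost p] by simp
  have "real M * cp (map_pmf h p) - 1 =
      (\<Sum>d\<in>?A\<times>?A. real M * (?w d * of_bool (h (fst d) = h (snd d)))) - (\<Sum>d\<in>?A\<times>?A. ?w d)"
    by (simp only: cp one sum_distrib_left)
  also have "\<dots> = (\<Sum>d\<in>?A\<times>?A. ?w d * centred_collision d h)"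
    unfolding sum_subtractf[symmetric] by (intro sum.cong refl) (simp add: centred_collision_def algebra_simps)
  also have "?A\<times>?A = {d\<in>?A \<times> ?A. fst d \<noteq> snd d} \<union> (\<lambda>x. (x, x)) ` ?A"
    by auto
  also have "(\<Sum>d\<in>\<dots>. ?w d * centred_collision d h) = (\<Sum>d\<in>{d\<in>?A \<times> ?A. fst d \<noteq> snd d}. ?w d * centred_collision d h) +
      (\<Sum>d\<in>(\<lambda>x. (x, x)) ` ?A. ?w d * centred_collision d h)"
    by (intro sum.union_disjoint) auto
  also have "(\<Sum>d\<in>(\<lambda>x. (x, x)) ` ?A. ?w d * centred_collision d h) = (real M - 1) * cp p"
    by (subst sum.reindex) (auto simp: inj_on_def centred_collision_def cp_eq_sum[OF finite_atLeastAtMost p]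
      sum_distrib_left power2_eq_square mult_ac)
  finally show ?thesis by simp
qed

text \<open>The threshold \<open>1 + M/K\<close> absorbs the deterministic term of
  \<open>cp_map_eq\<close>, which is at most \<open>M/K\<close>. Only the fluctuation can produce an
  excess, and its second moment is already bounded.\<close>

lemma expectation_excess_squared_le:
  fixes p :: "nat pmf"
  assumes p: "set_pmf p \<subseteq> {1..N}" and K: "K > 0" "cp p \<le> 1 / K"
  shows "hexp (\<lambda>h. (max 0 (real M * cp (map_pmf h p) - (1 + real M / K)))\<^sup>2)
    \<le> 2 * real M / K\<^sup>2"
proof -
  let ?S = "\<lambda>h. \<Sum>d\<in>{d\<in>{1..N} \<times> {1..N}. fst d \<noteq> snd d}. pmf p (fst d) * pmf p (snd d) * centred_collision d h"
  have "(max 0 (real M * cp (map_pmf h p) - (1 + real M / K)))\<^sup>2 \<le> (?S h)\<^sup>2" for h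
  proof -
    have "(real M - 1) * cp p \<le> real M * (1 / K)"
      using K cp_nonneg[of p] by (intro mult_mono) auto
    then have "real M * cp (map_pmf h p) - (1 + real M / K) \<le> ?S h"
      using cp_map_eq[OF p, of h] by simp
    then have "max 0 (real M * cp (map_pmf h p) - (1 + real M / K)) \<le> \<bar>?S h\<bar>" by linarith
    then have "(max 0 (real M * cp (map_pmf h p) - (1 + real M / K)))\<^sup>2 \<le> \<bar>?S h\<bar>\<^sup>2"
      by (intro power_mono) auto
    then show ?thesis by simp
  qed
  then have "hexp (\<lambda>h. (max 0 (real M * cp (map_pmf h p) - (1 + real M / K)))\<^sup>2)
      \<le> hexp (\<lambda>h. (?S h)\<^sup>2)"
    by (intro integral_mono integrable_HH)
  also have "\<dots> \<le> 2 * real M * (cp p)\<^sup>2" by (rule expectation_sum_centred_squared[OF p])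
  also have "\<dots> \<le> 2 * real M * (1 / K)\<^sup>2"
    using K cp_nonneg[of p] by (intro mult_left_mono power_mono) auto
  finally show ?thesis by (simp add: power_divide)
qed

end

subsection \<open>Blocks given their prefix\<close>

text \<open>Meaningful only if \<open>v\<close> is a prefix of an element of the support of \<open>P\<close>.\<close>

definition next_block :: "nat list pmf \<Rightarrow> nat list \<Rightarrow> nat pmf" where
  "next_block P v = map_pmf (\<lambda>xs. xs ! length v) (cond_pmf P {xs. take (length v) xs = v})"

lemma set_next_block:
  assumes "set_pmf P \<subseteq> words T M" "i < T" "v \<in> take i ` set_pmf P"
  shows "set_pmf (next_block P v) \<subseteq> {1..M}"
proof -
  have "length v = i" using assms by (auto simp: words_def)
  moreover from this have "set_pmf P \<inter> {xs. take (length v) xs = v} \<noteq> {}"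
    using assms(3) by auto
  ultimately show ?thesis
    using assms(1,2) unfolding next_block_def by (auto simp: words_def subset_iff)
qed

text \<open>One step of the chain rule: the mass of the prefix cancels the normalisation of the
  conditional law.\<close>

lemma pmf_next_block:
  assumes "w \<in> set_pmf P" "i < length w" "\<And>x. x \<in> set_pmf P \<Longrightarrow> length x = length w"
  shows "pmf (map_pmf (take i) P) (take i w) * pmf (next_block P (take i w)) (w ! i) =
    pmf (map_pmf (take (Suc i)) P) (take (Suc i) w)"
proof -
  let ?C = "{xs. take i xs = take i w}"
  have len: "length (take i w) = i" using assms(2) by simp
  have ne: "set_pmf P \<inter> ?C \<noteq> {}" using assms(1) by auto
  have pos: "measure P ?C \<noteq> 0" by (rule measure_measure_pmf_not_zero[OF ne])
  have "pmf (next_block P (take i w)) (w ! i) = measure (cond_pmf P ?C) ((\<lambda>xs. xs ! i) -` {w ! i})"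
    unfolding next_block_def len pmf_map ..
  also have "\<dots> = measure P (?C \<inter> (\<lambda>xs. xs ! i) -` {w ! i}) / measure P ?C"
    unfolding cond_pmf.rep_eq[OF ne] using pos
    by (intro measure_uniform_measure) (simp_all add: measure_pmf.emeasure_eq_measure)
  \<comment> \<open>The common length on the support makes position \<open>i\<close> exist, so
    agreement on the first \<open>i\<close> letters and at position \<open>i\<close> is agreement on
    \<open>Suc i\<close> letters.\<close>
  also have "measure P (?C \<inter> (\<lambda>xs. xs ! i) -` {w ! i}) = measure P (take (Suc i) -` {take (Suc i) w})"
  proof (intro measure_pmf.finite_measure_eq_AE AE_pmfI)
    fix x assume "x \<in> set_pmf P"
    from assms(3)[OF this] have "take (Suc i) x = take i x @ [x ! i]" "take (Suc i) w = take i w @ [w ! i]"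
      using assms(2) by (simp_all add: take_Suc_conv_app_nth)
    then show "x \<in> ?C \<inter> (\<lambda>xs. xs ! i) -` {w ! i} \<longleftrightarrow> x \<in> take (Suc i) -` {take (Suc i) w}"
      by simp
  qed simp_all
  finally show ?thesis using pos by (simp add: pmf_map vimage_def)
qed

lemma pmf_eq_prod_next_block:
  assumes "w \<in> set_pmf P" "\<And>x. x \<in> set_pmf P \<Longrightarrow> length x = T"
  shows "pmf P w = (\<Prod>i<T. pmf (next_block P (take i w)) (w ! i))"
proof -
  have len: "length w = T" using assms by auto
  have "(\<Prod>i<k. pmf (next_block P (take i w)) (w ! i)) = pmf (map_pmf (take k) P) (take k w)"
    if "k \<le> T" for k
    using that
  proof (induction k)
    case 0
    show ?case by (simp add: map_pmf_const)
  next
    case (Suc k)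
    then show ?case using pmf_next_block[of w P k] assms len by simp
  qed
  from this[of T] have "(\<Prod>i<T. pmf (next_block P (take i w)) (w ! i)) = pmf (map_pmf (take T) P) w"
    using len by simp
  also have "map_pmf (take T) P = map_pmf id P"
    using assms(2) by (intro map_pmf_cong) auto
  finally show ?thesis by simp
qed

text \<open>Given the hashed prefix, the true prefix \<open>u\<close> is still random among those
  that hash to \<open>v\<close>; given \<open>u\<close>, the next hashed block is the hash of the
  next block of \<open>X\<close>.\<close>

lemma next_block_map:
  assumes X: "set_pmf X \<subseteq> words T N" and i: "i < T" and v: "v \<in> take i ` map h ` set_pmf X"
  shows "next_block (map_pmf (map h) X) v =
    bind_pmf (cond_pmf (map_pmf (take i) X) {u. map h u = v}) (\<lambda>u. map_pmf h (next_block X u))"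
proof -
  have lenX: "length x = T" if "x \<in> set_pmf X" for x
    using that X by (auto simp: words_def)
  have len: "length v = i" using v i X by (auto simp: words_def)
  have ne: "set_pmf X \<inter> map h -` {xs. take i xs = v} \<noteq> {}" using v by auto
  have v': "v \<in> map h ` take i ` set_pmf X" using v by (auto simp: take_map)
  have ne': "set_pmf (map_pmf (take i) X) \<inter> {u. map h u = v} \<noteq> {}" using v' by auto
  have "next_block (map_pmf (map h) X) v =
      map_pmf (\<lambda>xs. map h xs ! i) (cond_pmf X (map h -` {xs. take i xs = v}))"
    unfolding next_block_def len cond_map_pmf[OF ne] map_pmf_comp ..
  also have "\<dots> = map_pmf (\<lambda>xs. h (xs ! i)) (cond_pmf X (map h -` {xs. take i xs = v}))"
    using ne lenX i by (intro map_pmf_cong) auto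
  also have "map h -` {xs. take i xs = v} = {xs. map h (take i xs) = v}"
    by (auto simp: take_map)
  also have "map_pmf (\<lambda>xs. h (xs ! i)) (cond_pmf X \<dots>) =
      bind_pmf (cond_pmf (map_pmf (take i) X) {u. map h u = v})
        (\<lambda>u. map_pmf (\<lambda>xs. h (xs ! i)) (cond_pmf X {xs. take i xs = u}))"
    unfolding cond_pmf_comp_eq_bind[OF v'] map_bind_pmf ..
  also have "\<dots> = bind_pmf (cond_pmf (map_pmf (take i) X) {u. map h u = v})
      (\<lambda>u. map_pmf h (next_block X u))"
  proof (intro bind_pmf_cong refl)
    fix u assume "u \<in> set_pmf (cond_pmf (map_pmf (take i) X) {u. map h u = v})"
    then have "map h u = v" using ne' by auto
    then have "length u = i" using len by auto
    then show "map_pmf (\<lambda>xs. h (xs ! i)) (cond_pmf X {xs. take i xs = u}) = map_pmf h (next_block X u)"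
      by (simp add: next_block_def map_pmf_comp)
  qed
  finally show ?thesis .
qed

text \<open>The conditional laws on the left depend on \<open>h\<close> through the whole hashed
  prefix. Jensen's inequality inside each fibre of prefixes, then total expectation over the fibres,
  replaces them by hashes of \<open>next_block X u\<close>, a law free of \<open>h\<close>, so that
  \<open>h\<close> can later be averaged with that law fixed.\<close>

lemma expectation_hinge_next_block_le:
  assumes X: "set_pmf X \<subseteq> words T N" and i: "i < T" and M: "M \<ge> 0"
  shows "measure_pmf.expectation (map_pmf (map h) X)
      (\<lambda>y. (max 0 (M * cp (next_block (map_pmf (map h) X) (take i y)) - a))\<^sup>2) \<le>
    measure_pmf.expectation X
      (\<lambda>x. (max 0 (M * cp (map_pmf h (next_block X (take i x))) - a))\<^sup>2)"
proof -
  let ?U = "map_pmf (take i) X"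
  let ?\<phi> = "\<lambda>t. (max 0 (M * t - a))\<^sup>2"
  have finX: "finite (set_pmf X)" using X finite_words by (rule finite_subset)
  then have finU: "finite (set_pmf ?U)" by simp
  have "measure_pmf.expectation (map_pmf (map h) X)
      (\<lambda>y. ?\<phi> (cp (next_block (map_pmf (map h) X) (take i y)))) =
    measure_pmf.expectation (map_pmf (map h) ?U)
      (\<lambda>v. ?\<phi> (cp (next_block (map_pmf (map h) X) v)))"
    by (simp add: take_map)
  also have "\<dots> \<le> measure_pmf.expectation (map_pmf (map h) ?U)
      (\<lambda>v. measure_pmf.expectation (cond_pmf ?U {u. map h u = v})
        (\<lambda>u. ?\<phi> (cp (map_pmf h (next_block X u)))))"
  proof (intro integral_mono_AE AE_pmfI)
    fix v assume "v \<in> set_pmf (map_pmf (map h) ?U)"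
    then have v: "v \<in> take i ` map h ` set_pmf X" by (simp add: image_image take_map)
    then have ne: "set_pmf ?U \<inter> {u. map h u = v} \<noteq> {}" by (auto simp: take_map)
    let ?w = "cond_pmf ?U {u. map h u = v}"
    have fin: "finite (set_pmf ?w)" using ne finU by simp
    have fin': "finite (set_pmf (map_pmf h (next_block X u)))" if "u \<in> set_pmf ?w" for u
    proof -
      have "u \<in> take i ` set_pmf X" using that ne by auto
      from finite_subset[OF set_next_block[OF X i this]] show ?thesis by simp
    qed
    have "M * cp (next_block (map_pmf (map h) X) v) \<le>
        M * measure_pmf.expectation ?w (\<lambda>u. cp (map_pmf h (next_block X u)))"
      unfolding next_block_map[OF X i v] using fin fin' M by (intro mult_left_mono cp_bind_le)
    also have "\<dots> = measure_pmf.expectation ?w (\<lambda>u. M * cp (map_pmf h (next_block X u)))"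
      by simp
    finally show "?\<phi> (cp (next_block (map_pmf (map h) X) v)) \<le>
        measure_pmf.expectation ?w (\<lambda>u. ?\<phi> (cp (map_pmf h (next_block X u))))"
      by (rule hinge_squared_le_expectation[OF fin])
  qed (use finX in \<open>auto intro!: integrable_measure_pmf_finite\<close>)
  also have "\<dots> = measure_pmf.expectation ?U (\<lambda>u. ?\<phi> (cp (map_pmf h (next_block X u))))"
    by (rule expectation_map_cond_pmf[OF finU])
  finally show ?thesis by simp
qed

subsection \<open>Hashing block sources\<close>

lemma exists_dominating_pmf:
  assumes P: "set_pmf P \<subseteq> words T M" and M: "M > 0" and b: "b \<ge> 1"
  obtains Q where "set_pmf Q \<subseteq> words T M" "cp Q \<le> b / real M ^ T"
    "\<And>y. y \<in> set_pmf P \<Longrightarrow> (\<Prod>i<T. real M * cp (next_block P (take i y))) \<le> b \<Longrightarrow>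
      pmf P y \<le> pmf Q y"
proof -
  \<comment> \<open>The uniform default covers lists that are not prefixes of the support: there
    \<open>next_block\<close> would condition on a null event, while
    \<open>dominating_pmf_small_cp\<close> asks for a law on \<open>{1..M}\<close> at every
    list.\<close>
  define \<kappa> where "\<kappa> v = (if v \<in> (\<Union>i<T. take i ` set_pmf P) then next_block P v
    else pmf_of_set {1..M})" for v
  have \<kappa>: "set_pmf (\<kappa> v) \<subseteq> {1..M}" for v
    using set_next_block[OF P] M by (auto simp: \<kappa>_def)
  have \<kappa>_eq: "\<kappa> (take i y) = next_block P (take i y)" if "i < T" "y \<in> set_pmf P" for i y
    using that by (auto simp: \<kappa>_def)
  obtain Q where *: "set_pmf Q \<subseteq> words T M \<and> cp Q \<le> b / real M ^ T \<and>
      (\<forall>w\<in>words T M. (\<Prod>i<T. real M * cp (\<kappa> ([] @ take i w))) \<le> b \<longrightarrow>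
        (\<Prod>i<T. pmf (\<kappa> ([] @ take i w)) (w ! i)) \<le> pmf Q w)"
    using dominating_pmf_small_cp[where \<kappa> = \<kappa> and v = "[]" and k = T, OF \<kappa> M b] by (elim exE)
  have Q: "set_pmf Q \<subseteq> words T M" "cp Q \<le> b / real M ^ T" using * by blast+
  have dom: "(\<Prod>i<T. pmf (\<kappa> (take i w)) (w ! i)) \<le> pmf Q w"
    if "w \<in> words T M" "(\<Prod>i<T. real M * cp (\<kappa> (take i w))) \<le> b" for w
    using * that by simp
  show thesis
  proof (rule that[OF Q])
    fix y assume y: "y \<in> set_pmf P" and le: "(\<Prod>i<T. real M * cp (next_block P (take i y))) \<le> b"
    have "pmf P y = (\<Prod>i<T. pmf (next_block P (take i y)) (y ! i))"
      using y by (rule pmf_eq_prod_next_block) (use P in \<open>auto simp: words_def\<close>)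
    also have "\<dots> = (\<Prod>i<T. pmf (\<kappa> (take i y)) (y ! i))"
      using y by (intro prod.cong) (auto simp: \<kappa>_eq)
    also have "\<dots> \<le> pmf Q y"
    proof (rule dom)
      have "(\<Prod>i<T. real M * cp (\<kappa> (take i y))) = (\<Prod>i<T. real M * cp (next_block P (take i y)))"
        using y by (intro prod.cong) (auto simp: \<kappa>_eq)
      then show "(\<Prod>i<T. real M * cp (\<kappa> (take i y))) \<le> b" using le by simp
    qed (use P y in blast)
    finally show "pmf P y \<le> pmf Q y" .
  qed
qed

text \<open>By Cauchy-Schwarz the mean excess over \<open>a\<close> is at most
  \<open>\<beta>\<close>, so the mean of the \<open>c i\<close> is at most
  \<open>a + \<beta>\<close>, and the geometric mean lies below the arithmetic one.\<close>

lemma prod_le_power_if_excess_small: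
  fixes c :: "nat \<Rightarrow> real"
  assumes T: "T > 0" and c: "\<And>i. i < T \<Longrightarrow> 0 \<le> c i" and "\<beta> \<ge> 0"
    and le: "(\<Sum>i<T. (max 0 (c i - a))\<^sup>2) \<le> real T * \<beta>\<^sup>2"
  shows "(\<Prod>i<T. c i) \<le> (a + \<beta>) ^ T"
proof -
  have "(\<Sum>i<T. max 0 (c i - a))\<^sup>2 \<le> (\<Sum>i<T. (max 0 (c i - a))\<^sup>2) * real T"
    using sum_squared_le_sum_of_squares[of "\<lambda>i. max 0 (c i - a)" "{..<T}"] by simp
  also have "\<dots> \<le> (real T * \<beta>)\<^sup>2"
    using mult_right_mono[OF le, of "real T"] by (simp add: power2_eq_square mult_ac)
  finally have "(\<Sum>i<T. max 0 (c i - a)) \<le> real T * \<beta>"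
    using \<open>\<beta> \<ge> 0\<close> by (auto intro: power2_le_imp_le)
  moreover have "(\<Sum>i<T. c i) \<le> (\<Sum>i<T. a + max 0 (c i - a))"
    by (intro sum_mono) auto
  ultimately have "(\<Sum>i<T. c i) \<le> real T * (a + \<beta>)"
    by (simp add: sum.distrib algebra_simps)
  then have mean: "(\<Sum>i<T. c i / real T) \<le> a + \<beta>"
    using T by (simp add: sum_divide_distrib[symmetric] field_simps)
  have nn: "0 \<le> (\<Prod>i<T. c i)" using c by (intro prod_nonneg) auto
  have "(\<Prod>i<T. c i) powr (1 / real T) \<le> a + \<beta>"
    using arith_geom_mean[of "{..<T}" c] c T mean by (auto simp: lessThan_empty_iff)
  then have "((\<Prod>i<T. c i) powr (1 / real T)) ^ T \<le> (a + \<beta>) ^ T"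
    by (intro power_mono) auto
  also have "((\<Prod>i<T. c i) powr (1 / real T)) ^ T = (\<Prod>i<T. c i)"
    using nn T by (cases "(\<Prod>i<T. c i) = 0") (simp_all add: powr_power del: prod_zero_iff)
  finally show ?thesis .
qed

lemma expectation_swap:
  fixes f :: "'a \<Rightarrow> 'b \<Rightarrow> real"
  assumes "finite (set_pmf p)" "finite (set_pmf q)"
  shows "measure_pmf.expectation p (\<lambda>x. measure_pmf.expectation q (\<lambda>y. f x y)) =
    measure_pmf.expectation q (\<lambda>y. measure_pmf.expectation p (\<lambda>x. f x y))"
proof -
  have p: "measure_pmf.expectation p g = (\<Sum>x\<in>set_pmf p. g x * pmf p x)" for g
    using assms by (intro integral_measure_pmf_real) auto
  have q: "measure_pmf.expectation q g = (\<Sum>x\<in>set_pmf q. g x * pmf q x)" for g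
    using assms by (intro integral_measure_pmf_real) auto
  show ?thesis
    unfolding p q sum_distrib_right by (subst sum.swap) (simp add: mult_ac)
qed

lemma finite_copies: "finite {(f, j). j < count A f}"
  and card_copies: "card {(f, j). j < count A f} = size A"
proof -
  have E: "{(f, j). j < count A f} = (SIGMA f:set_mset A. {..<count A f})"
    by (auto simp del: count_greater_zero_iff intro!: count_inI)
  show "finite {(f, j). j < count A f}" unfolding E by auto
  show "card {(f, j). j < count A f} = size A"
    unfolding E by (simp add: size_multiset_overloaded_eq)
qed

lemma copies_nonempty: "A \<noteq> {#} \<Longrightarrow> {(f, j). j < count A f} \<noteq> {}"
  using card_copies[of A] by (metis card.empty size_eq_0_iff_empty)

text \<open>Compare with \<open>exp s\<close>. The bound \<open>s \<le> 1\<close> enters both in the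
  quadratic estimate of the exponential and in replacing \<open>s\<^sup>2\<close> by
  \<open>s\<close>.\<close>

lemma one_plus_power_le:
  fixes s :: real
  assumes "T > 0" "0 \<le> s" "s \<le> 1"
  shows "(1 + s / real T) ^ T \<le> 1 + 2 * s"
proof -
  have "(1 + s / real T) ^ T \<le> exp s"
    using assms by (intro exp_ge_one_plus_x_over_n_power_n) auto
  also have "\<dots> \<le> 1 + s + s\<^sup>2" using assms by (intro exp_bound)
  also have "s\<^sup>2 \<le> s" using assms by (simp add: power2_eq_square mult_left_le)
  finally show ?thesis by simp
qed

theorem theorem3p5:
  fixes N M T :: nat and K \<epsilon> :: real
    and HH :: "(nat \<Rightarrow> nat) multiset" and X :: "nat list pmf"
  assumes "N > 0" and "M > 0" and "T > 0" and "K > 0"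
    and "hash_family N M HH"
    and "kwise_independent 4 N M HH"
    and "block_source T N K X"
    and "\<epsilon> > 0"
  shows "\<exists>HZ :: (((nat \<Rightarrow> nat) \<times> nat) \<times> nat list) pmf.
      map_pmf fst HZ = random_member HH \<and>
      set_pmf (map_pmf snd HZ) \<subseteq> words T M \<and>
      stat_dist (hashed_seq HH X) HZ \<le> \<epsilon> \<and>
      cp HZ \<le> 1 / (real (size HH) * real M ^ T) *
        (1 + real M / K + sqrt (2 * real M / (K\<^sup>2 * \<epsilon>))) ^ T \<and>
      (K \<ge> real M * real T + sqrt (2 * real M * (real T)\<^sup>2 / \<epsilon>) \<longrightarrow>
        (let \<gamma> = 2 * (real M * real T + sqrt (2 * real M * (real T)\<^sup>2 / \<epsilon>)) / K
         in cp HZ \<le> (1 + \<gamma>) / (real (size HH) * real M ^ T)))"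
proof -
  \<comment> \<open>The value for which the final Markov bound, \<open>T\<close> times
    \<open>2M/K\<^sup>2\<close> divided by \<open>T * \<beta>\<^sup>2\<close>, equals
    \<open>\<epsilon>\<close>.\<close>
  define \<beta> where "\<beta> = sqrt (2 * real M / (K\<^sup>2 * \<epsilon>))"
  define a where "a = 1 + real M / K"
  define b where "b = (a + \<beta>) ^ T"
  have \<beta>: "\<beta> > 0" "\<beta>\<^sup>2 = 2 * real M / (K\<^sup>2 * \<epsilon>)"
    using \<open>M > 0\<close> \<open>K > 0\<close> \<open>\<epsilon> > 0\<close> by (auto simp: \<beta>_def)
  have b1: "b \<ge> 1"
    unfolding b_def a_def using \<beta> \<open>K > 0\<close> by (intro one_le_power) (simp add: add_increasing2)
  have X: "set_pmf X \<subseteq> words T N" using \<open>block_source T N K X\<close> by (simp add: block_source_def)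
  have finX: "finite (set_pmf X)" using X finite_words by (rule finite_subset)
  have HH: "HH \<noteq> {#}" using \<open>hash_family N M HH\<close> by (simp add: hash_family_def)
  let ?E = "{(f, j). j < count HH f}"
  let ?R = "random_member HH"
  have setR: "set_pmf ?R = ?E"
    unfolding random_member_def by (rule set_pmf_of_set[OF copies_nonempty[OF HH] finite_copies])
  have pmfR: "pmf ?R r = 1 / real (size HH)" if "r \<in> ?E" for r
    using that unfolding random_member_def pmf_of_set[OF copies_nonempty[OF HH] finite_copies] card_copies
    by (simp only: indicator_simps)
  define P where "P h = map_pmf (map h) X" for h :: "nat \<Rightarrow> nat"
  have P: "set_pmf (P h) \<subseteq> words T M" if "h \<in># HH" for h
  proof -
    have "h \<in> {1..N} \<rightarrow>\<^sub>E {1..M}" using that \<open>hash_family N M HH\<close> by (auto simp: hash_family_def)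
    then show ?thesis using X by (force simp: P_def words_def PiE_iff)
  qed
  define good where "good h y \<longleftrightarrow> (\<Prod>i<T. real M * cp (next_block (P h) (take i y))) \<le> b" for h y
  have "\<forall>h. \<exists>Q. h \<in># HH \<longrightarrow> set_pmf Q \<subseteq> words T M \<and> cp Q \<le> b / real M ^ T \<and>
      (\<forall>y\<in>set_pmf (P h). good h y \<longrightarrow> pmf (P h) y \<le> pmf Q y)"
    unfolding good_def by (metis exists_dominating_pmf[OF P \<open>M > 0\<close> b1])
  from choice[OF this] obtain Q where *: "\<forall>h. h \<in># HH \<longrightarrow> set_pmf (Q h) \<subseteq> words T M \<and>
      cp (Q h) \<le> b / real M ^ T \<and> (\<forall>y\<in>set_pmf (P h). good h y \<longrightarrow> pmf (P h) y \<le> pmf (Q h) y)"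
    by (elim exE)
  have Q: "set_pmf (Q h) \<subseteq> words T M" "cp (Q h) \<le> b / real M ^ T" if "h \<in># HH" for h
    using * that by blast+
  have dom: "pmf (P h) y \<le> pmf (Q h) y" if "h \<in># HH" "y \<in> set_pmf (P h)" "good h y" for h y
    using * that by blast
  have finQ: "finite (set_pmf (Q h))" if "h \<in># HH" for h
    using Q(1)[OF that] finite_words by (rule finite_subset)
  \<comment> \<open>The member is drawn with its copy number but \<open>Q\<close> sees only the
    function. The hash component thus keeps its law, and each member has mass
    \<open>1 / size HH\<close> even when functions repeat.\<close>
  define HZ where "HZ = bind_pmf ?R (\<lambda>r. map_pmf (Pair r) (Q (fst r)))"
  have inHH: "fst r \<in># HH" if "r \<in> ?E" for r
    using that by (auto intro: count_inI)

  have "map_pmf fst HZ = ?R"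
    by (simp add: HZ_def map_bind_pmf map_pmf_comp map_pmf_const bind_return_pmf')
  moreover have "set_pmf (map_pmf snd HZ) \<subseteq> words T M"
    using Q(1) inHH by (fastforce simp: HZ_def setR)
  moreover have cpHZ: "cp HZ \<le> 1 / (real (size HH) * real M ^ T) * b"
  proof -
    have "cp HZ = (\<Sum>r\<in>?E. (pmf ?R r)\<^sup>2 * cp (Q (fst r)))"
      unfolding HZ_def using finQ inHH by (intro cp_bind_Pair finite_copies) (auto simp: setR)
    also have "\<dots> \<le> (\<Sum>r\<in>?E. (1 / real (size HH))\<^sup>2 * (b / real M ^ T))"
    proof (intro sum_mono)
      fix r assume r: "r \<in> ?E"
      show "(pmf ?R r)\<^sup>2 * cp (Q (fst r)) \<le> (1 / real (size HH))\<^sup>2 * (b / real M ^ T)"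
        unfolding pmfR[OF r] by (intro mult_left_mono Q(2) inHH r) auto
    qed
    also have "\<dots> = 1 / (real (size HH) * real M ^ T) * b"
      using HH by (simp add: card_copies power2_eq_square field_simps)
    finally show ?thesis .
  qed
  moreover have "stat_dist (hashed_seq HH X) HZ \<le> \<epsilon>"
  proof -
    let ?Y = "hashed_seq HH X"
    let ?\<phi> = "\<lambda>t. (max 0 (real M * t - a))\<^sup>2"
    define \<Psi> where "\<Psi> h y = (\<Sum>i<T. ?\<phi> (cp (next_block (P h) (take i y))))" for h y
    have Y: "?Y = bind_pmf ?R (\<lambda>r. map_pmf (Pair r) (P (fst r)))"
      unfolding hashed_seq_def pair_pmf_def P_def
      by (simp add: map_bind_pmf map_pmf_def bind_assoc_pmf bind_return_pmf)
    have finR: "finite (set_pmf ?R)" by (simp add: setR finite_copies)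
    have finY: "finite (set_pmf ?Y)" using finR finX by (simp add: Y P_def)
    \<comment> \<open>Stated as an implication so that points off the support also count as good;
      there the law of the hashed sequence is 0 and domination is trivial.\<close>
    let ?G = "{(r, y). r \<in> ?E \<and> y \<in> set_pmf (P (fst r)) \<longrightarrow> good (fst r) y}"
    have "stat_dist ?Y HZ \<le> measure_pmf.prob ?Y (- ?G)"
    proof (rule stat_dist_le)
      fix x assume x: "x \<in> ?G"
      obtain r y where ry: "x = (r, y)" by (cases x)
      show "pmf ?Y x \<le> pmf HZ x"
      proof (cases "r \<in> ?E \<and> y \<in> set_pmf (P (fst r))")
        case True
        then have "pmf (P (fst r)) y \<le> pmf (Q (fst r)) y"
          using x inHH by (intro dom) (auto simp: ry)
        then show ?thesis unfolding Y HZ_def ry pmf_bind_Pair by (intro mult_left_mono) auto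
      next
        case False
        then have "pmf ?R r = 0 \<or> pmf (P (fst r)) y = 0"
          by (simp only: pmf_eq_0_set_pmf setR) blast
        then have "pmf ?Y x = 0" unfolding Y ry pmf_bind_Pair by auto
        then show ?thesis by simp
      qed
    qed
    also have "\<dots> = measure_pmf.expectation ?Y (indicator (- ?G))" by simp
    \<comment> \<open>Markov's inequality: if \<open>\<Psi>\<close> were below
      \<open>T * \<beta>\<^sup>2\<close>, then \<open>prod_le_power_if_excess_small\<close> would
      keep the product within the budget.\<close>
    also have "\<dots> \<le> measure_pmf.expectation ?Y (\<lambda>x. \<Psi> (fst (fst x)) (snd x) / (real T * \<beta>\<^sup>2))"
    proof (intro integral_mono integrable_measure_pmf_finite[OF finY])
      fix x :: "((nat \<Rightarrow> nat) \<times> nat) \<times> nat list"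
      obtain r y where ry: "x = (r, y)" by (cases x)
      have "real T * \<beta>\<^sup>2 \<le> \<Psi> (fst r) y" if "\<not> good (fst r) y"
      proof (rule ccontr)
        assume "\<not> real T * \<beta>\<^sup>2 \<le> \<Psi> (fst r) y"
        then have "good (fst r) y"
          unfolding good_def b_def \<Psi>_def using \<open>T > 0\<close> \<beta>(1)
          by (intro prod_le_power_if_excess_small) (auto simp: cp_nonneg)
        with that show False ..
      qed
      moreover have "0 \<le> \<Psi> (fst r) y" unfolding \<Psi>_def by (intro sum_nonneg) auto
      ultimately show "indicator (- ?G) x \<le> \<Psi> (fst (fst x)) (snd x) / (real T * \<beta>\<^sup>2)"
        using \<open>T > 0\<close> \<beta>(1) by (auto simp: ry indicator_def)
    qed
    also have "\<dots> = measure_pmf.expectation ?Y (\<lambda>x. \<Psi> (fst (fst x)) (snd x)) / (real T * \<beta>\<^sup>2)"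
      by simp
    also have "measure_pmf.expectation ?Y (\<lambda>x. \<Psi> (fst (fst x)) (snd x)) =
        measure_pmf.expectation ?R (\<lambda>r. measure_pmf.expectation (P (fst r)) (\<Psi> (fst r)))"
    proof -
      have "measure_pmf.expectation ?Y (\<lambda>x. \<Psi> (fst (fst x)) (snd x)) =
          (\<Sum>r\<in>?E. pmf ?R r *\<^sub>R measure_pmf.expectation (map_pmf (Pair r) (P (fst r)))
            (\<lambda>x. \<Psi> (fst (fst x)) (snd x)))"
        unfolding Y using finX by (intro pmf_expectation_bind finite_copies) (auto simp: setR P_def)
      also have "\<dots> = measure_pmf.expectation ?R
          (\<lambda>r. measure_pmf.expectation (P (fst r)) (\<Psi> (fst r)))"
        by (subst integral_measure_pmf[OF finite_copies, of _ _ HH]) (auto simp: setR)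
      finally show ?thesis .
    qed
    \<comment> \<open>The integrand ignores the copy number, so the average passes to
      \<open>pmf_of_multiset HH\<close>, the law for which independence is assumed.\<close>
    also have "\<dots> = measure_pmf.expectation (pmf_of_multiset HH)
        (\<lambda>h. measure_pmf.expectation (P h) (\<Psi> h))"
      unfolding map_fst_random_member[OF HH, symmetric] by simp
    also have "\<dots> \<le> measure_pmf.expectation (pmf_of_multiset HH)
        (\<lambda>h. measure_pmf.expectation X (\<lambda>x. \<Sum>i<T. ?\<phi> (cp (map_pmf h (next_block X (take i x))))))"
    proof (intro integral_mono integrable_measure_pmf_finite)
      fix h
      have "measure_pmf.expectation (P h) (\<Psi> h) =
          (\<Sum>i<T. measure_pmf.expectation (P h) (\<lambda>y. ?\<phi> (cp (next_block (P h) (take i y)))))"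
        unfolding \<Psi>_def using finX
        by (intro Bochner_Integration.integral_sum integrable_measure_pmf_finite) (simp add: P_def)
      also have "\<dots> \<le> (\<Sum>i<T. measure_pmf.expectation X
          (\<lambda>x. ?\<phi> (cp (map_pmf h (next_block X (take i x))))))"
        unfolding P_def by (intro sum_mono expectation_hinge_next_block_le[OF X]) auto
      also have "\<dots> = measure_pmf.expectation X
          (\<lambda>x. \<Sum>i<T. ?\<phi> (cp (map_pmf h (next_block X (take i x)))))"
        using finX by (intro Bochner_Integration.integral_sum[symmetric] integrable_measure_pmf_finite)
      finally show "measure_pmf.expectation (P h) (\<Psi> h) \<le> \<dots>" .
    qed (use HH in simp_all)
    \<comment> \<open>With the prefix of \<open>x\<close> now fixed outside, \<open>h\<close> is
      averaged against one fixed block law, as the second moment bound requires.\<close>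
    also have "\<dots> = measure_pmf.expectation X (\<lambda>x. \<Sum>i<T. measure_pmf.expectation (pmf_of_multiset HH)
        (\<lambda>h. ?\<phi> (cp (map_pmf h (next_block X (take i x))))))"
      using HH finX by (subst expectation_swap)
        (simp_all add: Bochner_Integration.integral_sum integrable_measure_pmf_finite)
    also have "\<dots> \<le> measure_pmf.expectation X (\<lambda>x. \<Sum>i<T. 2 * real M / K\<^sup>2)"
    proof (intro integral_mono_AE AE_pmfI integrable_measure_pmf_finite[OF finX] sum_mono)
      fix x i assume x: "x \<in> set_pmf X" and "i \<in> {..<T}"
      then have i: "i < T" by simp
      have u: "take i x \<in> take i ` set_pmf X" using x by blast
      have len: "length (take i x) = i" using x X i by (auto simp: words_def)
      have "cp (next_block X (take i x)) \<le> 1 / K"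
        using \<open>block_source T N K X\<close> i u unfolding block_source_def next_block_def len by auto
      then show "measure_pmf.expectation (pmf_of_multiset HH)
          (\<lambda>h. ?\<phi> (cp (map_pmf h (next_block X (take i x))))) \<le> 2 * real M / K\<^sup>2"
        unfolding a_def
        by (intro expectation_excess_squared_le[OF \<open>M > 0\<close> \<open>hash_family N M HH\<close>
          \<open>kwise_independent 4 N M HH\<close> set_next_block[OF X i u] \<open>K > 0\<close>])
    qed
    finally have "stat_dist ?Y HZ \<le> real T * (2 * real M / K\<^sup>2) / (real T * \<beta>\<^sup>2)"
      using \<open>T > 0\<close> \<beta>(1) by (simp add: divide_right_mono)
    also have "\<dots> = \<epsilon>"
      unfolding \<beta>(2) using \<open>T > 0\<close> \<open>M > 0\<close> \<open>K > 0\<close> \<open>\<epsilon> > 0\<close> by (simp add: field_simps)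
    finally show ?thesis .
  qed
  moreover have "cp HZ \<le> (1 + 2 * (real M * real T + sqrt (2 * real M * (real T)\<^sup>2 / \<epsilon>)) / K) /
      (real (size HH) * real M ^ T)"
    if le: "K \<ge> real M * real T + sqrt (2 * real M * (real T)\<^sup>2 / \<epsilon>)"
  proof -
    \<comment> \<open>Chosen so that \<open>\<gamma> = 2 * s\<close> and
      \<open>a + \<beta> = 1 + s / T\<close>; the assumed lower bound on \<open>K\<close> says
      exactly that \<open>s \<le> 1\<close>.\<close>
    define s where "s = (real M * real T + sqrt (2 * real M * (real T)\<^sup>2 / \<epsilon>)) / K"
    have s: "0 \<le> s" "s \<le> 1" using le \<open>K > 0\<close> \<open>\<epsilon> > 0\<close> by (simp_all add: s_def)
    have "sqrt (2 * real M * (real T)\<^sup>2 / \<epsilon>) = real T * (K * \<beta>)"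
      using \<open>K > 0\<close> by (simp add: \<beta>_def real_sqrt_mult real_sqrt_divide field_simps)
    then have "a + \<beta> = 1 + s / real T"
      using \<open>K > 0\<close> \<open>T > 0\<close> by (simp add: s_def a_def field_simps)
    then have "b \<le> 1 + 2 * s"
      unfolding b_def using one_plus_power_le[OF \<open>T > 0\<close> s] by simp
    then have "1 / (real (size HH) * real M ^ T) * b \<le> 1 / (real (size HH) * real M ^ T) * (1 + 2 * s)"
      by (intro mult_left_mono) auto
    with cpHZ show ?thesis by (simp add: s_def)
  qed
  ultimately show ?thesis
    unfolding b_def a_def \<beta>_def Let_def by blast
qed

end
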